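(* Let $(X,\sigma,\tau)$ be an indecomposable multipermutation solution of level at most $2$, let $\widetilde 0\in X$ and $\pi=\sigma_{\widetilde 0}$. Then $(X,\sigma,\tau)$ is isomorphic to a solution of the form $\mathcal{S}(G\times\mathbb{Z}_n,\mathbf{c})$, for some $n\in\mathbb{N}\cup\{\infty\}$, some abelian group $(G,+,0)$ and some sequence $\mathbf{c}=(c_i)_{i\in\mathbb{Z}_n}$ in $G$ with $c_0=0$ such that $\{c_i\mid i\in\mathbb{Z}_n\}$ generates $G$, if and only if $$\mathrm{Dis}(X)\cap\langle\pi\rangle=\{\mathrm{id}\}\quad\text{and}\quad \mathcal{G}(X)_{\widetilde 0}\subseteq\mathrm{Dis}(X).$$
   Context: $\mathbb{N}$ denotes the positive integers. $\mathbb{Z}_n=\mathbb{Z}/n\mathbb{Z}$ for finite $n$, and $\mathbb{Z}_\infty=\mathbb{Z}$. A solution (set-theoretic, non-degenerate, involutive solution of the Yang-Baxter equation) is a triple $(X,\sigma,\tau)$ with $X$ a non-empty set and $\sigma,\tau\colon X^2\to X$ such that, writing $\sigma_x=\sigma(x,\cdot)$ and $\tau_y=\tau(\cdot,y)$, the map $r(x,y)=(\sigma_x(y),\tau_y(x))$ is a bijection of $X^2$ satisfying $(\mathrm{id}\times r)(r\times \mathrm{id})(\mathrm{id}\times r)=(r\times \mathrm{id})(\mathrm{id}\times r)(r\times \mathrm{id})$, all $\sigma_x,\tau_y$ are bijections, and $r^2=\mathrm{id}$. The permutation group is $\mathcal{G}(X)=\langle\sigma_x\mid x\in X\rangle\le\mathrm{Sym}(X)$;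 the solution is indecomposable if $\mathcal{G}(X)$ is transitive on $X$. $\mathcal{G}(X)_{\widetilde 0}$ is the stabilizer of $\widetilde 0$ in $\mathcal{G}(X)$. The displacement group is $\mathrm{Dis}(X)=\langle\sigma_x\sigma_y^{-1}\mid x,y\in X\rangle$. Put $x\sim y$ iff $\tau_x=\tau_y$. The quotient $X/{\sim}$ carries an induced solution, the retraction $\mathrm{Ret}(X)$. The solution has multipermutation level $1$ if $|\mathrm{Ret}(X)|=1$, and level $2$ if $|\mathrm{Ret}(X)|>1$ and $|\mathrm{Ret}(\mathrm{Ret}(X))|=1$. $\mathcal{S}(G\times\mathbb{Z}_n,\mathbf{c})$ denotes the solution $(G\times\mathbb{Z}_n,\sigma,\tau)$ with $\sigma_{(a,i)}((b,j))=(b+c_{i-j-1}-c_{-j-1},j+1)$ and $\tau_{(a,i)}((b,j))=(b-c_{i-j+1}+c_{-j},j-1)$. A homomorphism from $(X,\sigma,\tau)$ to $(X',\sigma',\tau')$ is a map $\Phi\colon X\to X'$ with $\Phi\sigma_x=\sigma'_{\Phi(x)}\Phi$ for all $x$; an isomorphism is a bijective homomorphism. *)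

theory Defs
  imports "HOL-Algebra.Elementary_Groups" "HOL-Algebra.Group_Action" "HOL-Library.Extended_Nat"
begin

section \<open>Set-theoretic solutions of the Yang--Baxter equation\<close>

text \<open>
  Both operations take the index first: \<open>sigma X x y\<close> is \<open>\<sigma>\<^sub>x(y) = \<sigma>(x, y)\<close> and
  \<open>tau X y x\<close> is \<open>\<tau>\<^sub>y(x) = \<tau>(x, y)\<close>. Their values outside \<open>carrier X\<close> are irrelevant.
\<close>

record 'a ybe = "'a partial_object" +
  sigma :: "'a \<Rightarrow> 'a \<Rightarrow> 'a"
  tau :: "'a \<Rightarrow> 'a \<Rightarrow> 'a"

definition ybe_map :: "'a ybe \<Rightarrow> 'a \<times> 'a \<Rightarrow> 'a \<times> 'a" where
  "ybe_map X = (\<lambda>(x, y). (sigma X x y, tau X y x))"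

definition on_left :: "('a \<times> 'a \<Rightarrow> 'a \<times> 'a) \<Rightarrow> 'a \<times> 'a \<times> 'a \<Rightarrow> 'a \<times> 'a \<times> 'a" where
  "on_left r = (\<lambda>(x, y, z). case r (x, y) of (u, v) \<Rightarrow> (u, v, z))"

definition on_right :: "('a \<times> 'a \<Rightarrow> 'a \<times> 'a) \<Rightarrow> 'a \<times> 'a \<times> 'a \<Rightarrow> 'a \<times> 'a \<times> 'a" where
  "on_right r = map_prod id r"

locale ybe_solution =
  fixes X :: "'a ybe"
  assumes nonempty: "carrier X \<noteq> {}"
    and bij_ybe_map: "bij_betw (ybe_map X) (carrier X \<times> carrier X) (carrier X \<times> carrier X)"
    and braid: "\<And>p. p \<in> carrier X \<times> carrier X \<times> carrier X \<Longrightarrow>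
        on_right (ybe_map X) (on_left (ybe_map X) (on_right (ybe_map X) p)) =
        on_left (ybe_map X) (on_right (ybe_map X) (on_left (ybe_map X) p))"
    and bij_sigma: "\<And>x. x \<in> carrier X \<Longrightarrow> bij_betw (sigma X x) (carrier X) (carrier X)"
    and bij_tau: "\<And>y. y \<in> carrier X \<Longrightarrow> bij_betw (tau X y) (carrier X) (carrier X)"
    and involutive: "\<And>p. p \<in> carrier X \<times> carrier X \<Longrightarrow> ybe_map X (ybe_map X p) = p"


section \<open>Permutation group and displacement group\<close>

text \<open>\<open>BijGroup\<close> consists of extensional functions, hence the restriction.\<close>

definition sigma_perm :: "'a ybe \<Rightarrow> 'a \<Rightarrow> ('a \<Rightarrow> 'a)" where
  "sigma_perm X x = restrict (sigma X x) (carrier X)"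

definition perm_group :: "'a ybe \<Rightarrow> ('a \<Rightarrow> 'a) monoid" where
  "perm_group X = subgroup_generated (BijGroup (carrier X)) (sigma_perm X ` carrier X)"

definition dis_group :: "'a ybe \<Rightarrow> ('a \<Rightarrow> 'a) monoid" where
  "dis_group X = subgroup_generated (BijGroup (carrier X))
     {sigma_perm X x \<otimes>\<^bsub>BijGroup (carrier X)\<^esub> inv\<^bsub>BijGroup (carrier X)\<^esub> (sigma_perm X y) | x y.
        x \<in> carrier X \<and> y \<in> carrier X}"

definition indecomposable :: "'a ybe \<Rightarrow> bool" where
  "indecomposable X \<longleftrightarrow> transitive_action (perm_group X) (carrier X) (\<lambda>g. g)"


section \<open>Retraction and multipermutation level\<close>

definition ret_rel :: "'a ybe \<Rightarrow> ('a \<times> 'a) set" where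
  "ret_rel X = {(x, y) \<in> carrier X \<times> carrier X. \<forall>z \<in> carrier X. tau X x z = tau X y z}"

text \<open>
  \<open>quotient_op R f [x] [y] = [f x y]\<close> whenever \<open>f\<close> respects the equivalence relation \<open>R\<close>,
  which is the case for both operations of a solution and its retraction relation.
\<close>

definition quotient_op :: "('a \<times> 'a) set \<Rightarrow> ('a \<Rightarrow> 'a \<Rightarrow> 'a) \<Rightarrow> 'a set \<Rightarrow> 'a set \<Rightarrow> 'a set" where
  "quotient_op R f A B = (\<Union>x\<in>A. \<Union>y\<in>B. R `` {f x y})"

definition Ret :: "'a ybe \<Rightarrow> 'a set ybe" where
  "Ret X = \<lparr>carrier = carrier X // ret_rel X,
            sigma = quotient_op (ret_rel X) (sigma X),
            tau = quotient_op (ret_rel X) (tau X)\<rparr>"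

definition mp_level_1 :: "'a ybe \<Rightarrow> bool" where
  "mp_level_1 X \<longleftrightarrow> is_singleton (carrier (Ret X))"

definition mp_level_2 :: "'a ybe \<Rightarrow> bool" where
  "mp_level_2 X \<longleftrightarrow> (\<exists>A \<in> carrier (Ret X). \<exists>B \<in> carrier (Ret X). A \<noteq> B) \<and>
                     is_singleton (carrier (Ret (Ret X)))"


section \<open>Isomorphisms\<close>

definition ybe_hom :: "'a ybe \<Rightarrow> 'b ybe \<Rightarrow> ('a \<Rightarrow> 'b) set" where
  "ybe_hom X Y = {\<Phi> \<in> carrier X \<rightarrow> carrier Y.
     \<forall>x \<in> carrier X. \<forall>y \<in> carrier X. \<Phi> (sigma X x y) = sigma Y (\<Phi> x) (\<Phi> y)}"

definition ybe_isomorphic :: "'a ybe \<Rightarrow> 'b ybe \<Rightarrow> bool" where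
  "ybe_isomorphic X Y \<longleftrightarrow> (\<exists>\<Phi> \<in> ybe_hom X Y. bij_betw \<Phi> (carrier X) (carrier Y))"


section \<open>The solutions \<open>\<S>(G \<times> \<int>\<^sub>n, c)\<close>\<close>

text \<open>
  For finite \<open>n\<close> the elements of \<open>\<int>\<^sub>n\<close> are the representatives \<open>0, \<dots>, n - 1\<close>, and
  \<open>zclass n k\<close> is the representative of the class of \<open>k\<close>.
\<close>

definition Z_group :: "enat \<Rightarrow> int monoid" where
  "Z_group n = (case n of enat m \<Rightarrow> integer_mod_group m | \<infinity> \<Rightarrow> integer_group)"

definition zclass :: "enat \<Rightarrow> int \<Rightarrow> int" where
  "zclass n k = (case n of enat m \<Rightarrow> k mod int m | \<infinity> \<Rightarrow> k)"

lemma zclass_hom: "zclass n \<in> hom integer_group (Z_group n)"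
  by (cases n) (auto simp: hom_def zclass_def Z_group_def integer_mod_group_def
      integer_group_def mod_add_eq)

lemma zclass_id: "k \<in> carrier (Z_group n) \<Longrightarrow> zclass n k = k"
  by (cases n) (auto simp: zclass_def Z_group_def carrier_integer_mod_group split: if_splits)

text \<open>The group \<open>G\<close> is written multiplicatively.\<close>

definition S_sol :: "'g monoid \<Rightarrow> enat \<Rightarrow> (int \<Rightarrow> 'g) \<Rightarrow> ('g \<times> int) ybe" where
  "S_sol G n c =
     \<lparr>carrier = carrier G \<times> carrier (Z_group n),
      sigma = (\<lambda>(a, i) (b, j).
        (b \<otimes>\<^bsub>G\<^esub> c (zclass n (i - j - 1)) \<otimes>\<^bsub>G\<^esub> inv\<^bsub>G\<^esub> c (zclass n (- j - 1)), zclass n (j + 1))),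
      tau = (\<lambda>(a, i) (b, j).
        (b \<otimes>\<^bsub>G\<^esub> inv\<^bsub>G\<^esub> c (zclass n (i - j + 1)) \<otimes>\<^bsub>G\<^esub> c (zclass n (- j)), zclass n (j - 1)))\<rparr>"

text \<open>
  HOL cannot quantify over types inside a formula, so the type that the abelian group \<open>G\<close>
  lives in is a parameter.
\<close>

definition has_S_form :: "'g itself \<Rightarrow> 'a ybe \<Rightarrow> bool" where
  "has_S_form (_ :: 'g itself) X \<longleftrightarrow>
     (\<exists>(n::enat) (G::'g monoid) (c::int \<Rightarrow> 'g).
        n \<ge> 1 \<and> comm_group G \<and> c \<in> carrier (Z_group n) \<rightarrow> carrier G \<and> c 0 = \<one>\<^bsub>G\<^esub> \<and>
        generate G (c ` carrier (Z_group n)) = carrier G \<and>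
        ybe_isomorphic X (S_sol G n c))"

end

theory Submission
  imports Defs "HOL-Algebra.Multiplicative_Group"
begin

text \<open>
  Level at most two means that all \<open>\<sigma>\<^sub>x\<close> induce the same permutation of the retraction. By
  transitivity every \<open>\<sigma>\<^sub>x\<close> is then one of the \<open>s k = \<sigma>\<^sub>u\<close> with \<open>u = \<pi>\<^sup>k(z)\<close>, and the braid
  relation becomes \<open>s i s j = s (j + 1) s (i - 1)\<close>. Hence the quotients of the \<open>s i\<close> generate an
  abelian group \<open>Dis(X)\<close>, on which conjugation by \<open>\<pi>\<close> acts by shifting indices, and
  \<open>\<G>(X) = Dis(X)\<langle>\<pi>\<rangle>\<close>.

  If the two group conditions hold, \<open>(d z, k) \<mapsto> \<pi>\<^sup>k(d z)\<close> is a bijection onto \<open>X\<close> from the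
  product of the orbit \<open>Dis(X) z\<close>, an abelian group as the quotient of \<open>Dis(X)\<close> by the stabilizer,
  and \<open>\<int>\<^sub>n\<close> with \<open>n\<close> the order of \<open>\<pi>\<close>; it carries \<open>\<S>(G \<times> \<int>\<^sub>n, c)\<close> to \<open>X\<close> for
  \<open>c k = (s k)(s 0)\<^sup>-\<^sup>1 z\<close>. Conversely, in \<open>\<S>(G \<times> \<int>\<^sub>n, c)\<close> the group \<open>Dis(X)\<close> preserves the second
  coordinate, \<open>\<pi>\<close> increments it, and \<open>\<pi>\<^sup>n\<close> is the identity because its first coordinate
  telescopes over a full cycle.
\<close>

section \<open>The retraction relation\<close>

context ybe_solution
begin

lemma sigma_closed [simp, intro]: "x \<in> carrier X \<Longrightarrow> y \<in> carrier X \<Longrightarrow> sigma X x y \<in> carrier X"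
  using bij_sigma by (auto dest: bij_betwE)

lemma tau_closed [simp, intro]: "x \<in> carrier X \<Longrightarrow> y \<in> carrier X \<Longrightarrow> tau X x y \<in> carrier X"
  using bij_tau by (auto dest: bij_betwE)

lemma sigma_inject:
  "x \<in> carrier X \<Longrightarrow> y \<in> carrier X \<Longrightarrow> y' \<in> carrier X \<Longrightarrow> sigma X x y = sigma X x y' \<longleftrightarrow> y = y'"
  using bij_sigma by (auto simp: bij_betw_def dest: inj_onD)

lemma tau_inject:
  "x \<in> carrier X \<Longrightarrow> y \<in> carrier X \<Longrightarrow> y' \<in> carrier X \<Longrightarrow> tau X x y = tau X x y' \<longleftrightarrow> y = y'"
  using bij_tau by (auto simp: bij_betw_def dest: inj_onD)

lemma tau_surj:
  assumes "x \<in> carrier X" "y \<in> carrier X" obtains w where "w \<in> carrier X" "tau X x w = y"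
  using that bij_betw_imp_surj_on[OF bij_tau[OF assms(1)]] assms(2) by (metis imageE)

lemma sigma_sigma_tau:
  assumes "x \<in> carrier X" "y \<in> carrier X"
  shows "sigma X (sigma X x y) (tau X y x) = x"
  using involutive[of "(x, y)"] assms by (simp add: ybe_map_def)

lemma tau_tau_sigma:
  assumes "x \<in> carrier X" "y \<in> carrier X"
  shows "tau X (tau X y x) (sigma X x y) = y"
  using involutive[of "(x, y)"] assms by (simp add: ybe_map_def)

lemma braid_sigma:
  assumes "x \<in> carrier X" "y \<in> carrier X" "z \<in> carrier X"
  shows "sigma X x (sigma X y z) = sigma X (sigma X x y) (sigma X (tau X y x) z)"
  using braid[of "(x, y, z)"] assms by (simp add: ybe_map_def on_left_def on_right_def)

lemma braid_tau:
  assumes "x \<in> carrier X" "y \<in> carrier X" "z \<in> carrier X"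
  shows "tau X (tau X z y) (tau X (sigma X y z) x) = tau X z (tau X y x)"
  using braid[of "(x, y, z)"] assms by (simp add: ybe_map_def on_left_def on_right_def)

section \<open>The retraction relation and its compatibility with \<tau>\<close>

lemma ret_rel_refl: "x \<in> carrier X \<Longrightarrow> (x, x) \<in> ret_rel X"
  by (simp add: ret_rel_def)

lemma ret_rel_sym: "(x, y) \<in> ret_rel X \<Longrightarrow> (y, x) \<in> ret_rel X"
  by (auto simp: ret_rel_def)

lemma ret_rel_trans: "(x, y) \<in> ret_rel X \<Longrightarrow> (y, w) \<in> ret_rel X \<Longrightarrow> (x, w) \<in> ret_rel X"
  by (auto simp: ret_rel_def)

lemma ret_rel_carrier: "(x, y) \<in> ret_rel X \<Longrightarrow> x \<in> carrier X \<and> y \<in> carrier X"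
  by (auto simp: ret_rel_def)

lemma ret_rel_tau: "(x, y) \<in> ret_rel X \<Longrightarrow> w \<in> carrier X \<Longrightarrow> tau X x w = tau X y w"
  by (auto simp: ret_rel_def)

lemma equiv_ret_rel: "equiv (carrier X) (ret_rel X)"
  by (intro equivI refl_onI symI transI)
     (auto intro: ret_rel_refl ret_rel_sym ret_rel_trans dest: ret_rel_carrier)

text \<open>
  The map \<open>T\<close> with \<open>tau X y (T y) = y\<close> satisfies \<open>sigma X (T y) y = T y\<close>, hence is injective,
  and conjugates \<open>sigma X u\<close> into the inverse of \<open>tau X u\<close>.
\<close>

lemma ret_rel_sigma:
  assumes "(u, u') \<in> ret_rel X" "y \<in> carrier X"
  shows "sigma X u y = sigma X u' y"
proof -
  have u: "u \<in> carrier X" "u' \<in> carrier X"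
    using assms(1) by (auto dest: ret_rel_carrier)
  have fixed: "sigma X t w = t" if "w \<in> carrier X" "t \<in> carrier X" "tau X w t = w" for w t
    using tau_tau_sigma[OF that(2,1)] that tau_inject[of w "sigma X t w" t] by auto
  have conj: "tau X v t' = t"
    if v: "v \<in> carrier X" and t: "t \<in> carrier X" "tau X y t = y"
      and t': "t' \<in> carrier X" "tau X (sigma X v y) t' = sigma X v y" for v t t'
  proof -
    have "tau X y (tau X v t') = tau X (tau X y v) (sigma X v y)"
      using braid_tau[of t' v y] v t' assms(2) by simp
    also have "\<dots> = y"
      using tau_tau_sigma v assms(2) by simp
    finally show ?thesis
      using tau_inject[of y "tau X v t'" t] v t t' assms(2) by simp
  qed
  obtain t where t: "t \<in> carrier X" "tau X y t = y"
    using tau_surj assms(2) by metis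
  obtain w where w: "w \<in> carrier X" "tau X (sigma X u y) w = sigma X u y"
    using tau_surj sigma_closed u assms(2) by metis
  obtain w' where w': "w' \<in> carrier X" "tau X (sigma X u' y) w' = sigma X u' y"
    using tau_surj sigma_closed u assms(2) by metis
  have "tau X u w = tau X u w'"
    using conj[OF u(1) t w] conj[OF u(2) t w'] ret_rel_tau[OF assms(1)] w' by simp
  then have "w = w'"
    using tau_inject u w w' by blast
  moreover have "sigma X w (sigma X u y) = w" "sigma X w' (sigma X u' y) = w'"
    using fixed w w' u assms(2) by auto
  ultimately show ?thesis
    using sigma_inject[of w "sigma X u y" "sigma X u' y"] w u assms(2) by auto
qed

text \<open>By \<open>braid_tau\<close>, the map \<tau> at \<open>tau X x y\<close> is determined by
  the maps \<tau> at \<open>x\<close>, \<open>y\<close> and \<open>sigma X y x\<close>. Replacing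
  \<open>y\<close> by \<open>y'\<close> changes none of them, the last one by
  \<open>ret_rel_sigma\<close>.\<close>

lemma tau_respects_ret_rel:
  assumes "(y, y') \<in> ret_rel X" "x \<in> carrier X"
  shows "(tau X x y, tau X x y') \<in> ret_rel X"
proof -
  have y: "y \<in> carrier X" "y' \<in> carrier X"
    using assms(1) by (auto dest: ret_rel_carrier)
  have "tau X (tau X x y) a = tau X (tau X x y') a" if a: "a \<in> carrier X" for a
  proof -
    obtain b where b: "b \<in> carrier X" "tau X (sigma X y x) b = a"
      using tau_surj[OF sigma_closed[OF y(1) assms(2)] a] by blast
    have "tau X (tau X x y) a = tau X x (tau X y b)"
      using braid_tau[of b y x] b y assms(2) by simp
    also have "\<dots> = tau X x (tau X y' b)"
      using ret_rel_tau[OF assms(1)] b by simp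
    also have "\<dots> = tau X (tau X x y') (tau X (sigma X y' x) b)"
      using braid_tau[of b y' x] b y assms(2) by simp
    also have "\<dots> = tau X (tau X x y') a"
      using ret_rel_sigma[OF assms] b by simp
    finally show ?thesis .
  qed
  then show ?thesis
    using y assms(2) by (auto simp: ret_rel_def)
qed

text \<open>The equal maps \<tau> at \<open>tau X x y\<close> and \<open>tau X x y'\<close> send
  \<open>sigma X y x\<close> and \<open>sigma X y' x\<close> both to \<open>x\<close>, so these
  points agree. Now \<open>braid_tau\<close> equates the composites of \<tau> at \<open>x\<close>
  with \<tau> at \<open>y\<close> and at \<open>y'\<close>, and \<tau> at \<open>x\<close>
  cancels.\<close>

lemma tau_reflects_ret_rel:
  assumes "(tau X x y, tau X x y') \<in> ret_rel X" "x \<in> carrier X" "y \<in> carrier X" "y' \<in> carrier X"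
  shows "(y, y') \<in> ret_rel X"
proof -
  have "tau X (tau X x y) (sigma X y x) = tau X (tau X x y') (sigma X y' x)"
    using tau_tau_sigma assms by simp
  also have "\<dots> = tau X (tau X x y) (sigma X y' x)"
    using ret_rel_tau[OF assms(1)] assms by simp
  finally have eq: "sigma X y x = sigma X y' x"
    using tau_inject assms by simp
  have "tau X y a = tau X y' a" if a: "a \<in> carrier X" for a
  proof -
    have "tau X x (tau X y a) = tau X (tau X x y) (tau X (sigma X y x) a)"
      using braid_tau[of a y x] a assms by simp
    also have "\<dots> = tau X (tau X x y') (tau X (sigma X y' x) a)"
      using ret_rel_tau[OF assms(1)] eq a assms by simp
    also have "\<dots> = tau X x (tau X y' a)"
      using braid_tau[of a y' x] a assms by simp
    finally show ?thesis
      using tau_inject a assms by simp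
  qed
  then show ?thesis
    using assms by (auto simp: ret_rel_def)
qed

text \<open>The union in \<open>quotient_op\<close> collapses to one class: changing
  \<open>x\<close> within its class changes no value, changing \<open>y\<close> stays in the class
  of the value.\<close>

lemma quotient_op_tau:
  assumes "x \<in> carrier X" "y \<in> carrier X"
  shows "quotient_op (ret_rel X) (tau X) (ret_rel X `` {x}) (ret_rel X `` {y}) = ret_rel X `` {tau X x y}"
proof -
  have "ret_rel X `` {tau X x' y'} = ret_rel X `` {tau X x y}"
    if x': "(x, x') \<in> ret_rel X" and y': "(y, y') \<in> ret_rel X" for x' y'
  proof (rule equiv_class_eq[OF equiv_ret_rel])
    show "(tau X x' y', tau X x y) \<in> ret_rel X"
      using tau_respects_ret_rel[OF ret_rel_sym[OF y'] assms(1)] ret_rel_tau[OF x', of y']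
        ret_rel_carrier[OF y'] by simp
  qed
  then show ?thesis
    using ret_rel_refl assms unfolding quotient_op_def by blast
qed

text \<open>At level 1 already \<open>x\<close> and \<open>y\<close> are related. At level 2 their
  classes are related in \<open>Ret X\<close>, hence have the same \<tau> there, and
  \<open>quotient_op_tau\<close> reads this back in \<open>X\<close>.\<close>

lemma level_at_most_2_tau:
  assumes "mp_level_1 X \<or> mp_level_2 X" "x \<in> carrier X" "y \<in> carrier X" "w \<in> carrier X"
  shows "(tau X x w, tau X y w) \<in> ret_rel X"
  using assms(1)
proof
  assume "mp_level_1 X"
  moreover have "ret_rel X `` {x} \<in> carrier (Ret X)" "ret_rel X `` {y} \<in> carrier (Ret X)"
    using assms by (auto simp: Ret_def intro: quotientI)
  ultimately have "ret_rel X `` {x} = ret_rel X `` {y}"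
    unfolding mp_level_1_def is_singleton_def by auto
  then have "(x, y) \<in> ret_rel X"
    using ret_rel_refl[OF assms(3)] by auto
  then show ?thesis
    using ret_rel_tau assms ret_rel_refl tau_closed by metis
next
  assume "mp_level_2 X"
  then have sing: "is_singleton (carrier (Ret (Ret X)))"
    by (simp add: mp_level_2_def)
  let ?R = "ret_rel (Ret X)"
  have c: "ret_rel X `` {a} \<in> carrier (Ret X)" if "a \<in> carrier X" for a
    using that by (auto simp: Ret_def intro: quotientI)
  have "?R `` {ret_rel X `` {x}} = ?R `` {ret_rel X `` {y}}"
    using sing quotientI[OF c, of x ?R] quotientI[OF c, of y ?R] assms
    unfolding is_singleton_def by (auto simp: Ret_def)
  moreover have "ret_rel X `` {y} \<in> ?R `` {ret_rel X `` {y}}"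
    using c[OF assms(3)] by (simp add: ret_rel_def[of "Ret X"])
  ultimately have "(ret_rel X `` {x}, ret_rel X `` {y}) \<in> ?R"
    by blast
  then have "tau (Ret X) (ret_rel X `` {x}) (ret_rel X `` {w})
      = tau (Ret X) (ret_rel X `` {y}) (ret_rel X `` {w})"
    using c[OF assms(4)] by (auto simp: ret_rel_def[of "Ret X"])
  then have "ret_rel X `` {tau X x w} = ret_rel X `` {tau X y w}"
    using quotient_op_tau assms by (simp add: Ret_def)
  then show ?thesis
    using eq_equiv_class[OF _ equiv_ret_rel] assms by simp
qed

end

section \<open>Families of group elements with a shifted commutation rule\<close>

text \<open>Group theory that follows from the braid relation alone. The index runs over all
  integers and no periodicity is assumed, so finite and infinite order of \<pi> are treated
  together.\<close>

locale shift_family = group G for G (structure) +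
  fixes s :: "int \<Rightarrow> 'a"
  assumes s_closed [simp, intro]: "s i \<in> carrier G"
    and s_swap: "s i \<otimes> s j = s (j + 1) \<otimes> s (i - 1)"
begin

definition quot :: "int \<Rightarrow> int \<Rightarrow> 'a" where
  "quot i j = s i \<otimes> inv s j"

definition quots :: "'a set" where
  "quots = generate G {quot i j | i j. True}"

lemma quot_closed [simp, intro]: "quot i j \<in> carrier G"
  by (simp add: quot_def)

lemma inv_quot: "inv quot i j = quot j i"
  by (simp add: quot_def inv_mult_group)

lemma quot_mult: "quot i j \<otimes> quot j k = quot i k"
  by (simp add: quot_def m_assoc inv_solve_left')

lemma subgroup_quots: "subgroup quots G"
  unfolding quots_def by (rule generate_is_subgroup) auto

lemma quots_closed: "d \<in> quots \<Longrightarrow> d \<in> carrier G"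
  using subgroup.mem_carrier[OF subgroup_quots] .

lemma quot_in_quots [simp, intro]: "quot i j \<in> quots"
  unfolding quots_def by (rule generate.incl) auto

text \<open>\<open>s_swap\<close> with its outer factors moved across. It carries an inverse from
  left to right, so that products of quotients can be sorted.\<close>

lemma inv_s_mult: "inv s (j + 1) \<otimes> s i = s (i - 1) \<otimes> inv s j"
proof -
  have "s i \<otimes> s j = s (j + 1) \<otimes> s (i - 1)"
    by (rule s_swap)
  then have "inv s (j + 1) \<otimes> (s i \<otimes> s j) = s (i - 1)"
    by (simp add: inv_solve_left')
  then show ?thesis
    by (metis inv_closed inv_solve_right m_assoc m_closed s_closed)
qed

text \<open>Sorting positive factors before inverses gives \<open>s i \<otimes> s (k - 1)\<close>
  times the inverse of \<open>s l \<otimes> s (j - 1)\<close>. By \<open>s_swap\<close> the first is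
  symmetric in \<open>i\<close> and \<open>k\<close>, the second in \<open>j\<close> and
  \<open>l\<close>.\<close>

lemma quot_commute: "quot i j \<otimes> quot k l = quot k l \<otimes> quot i j"
proof -
  have gen: "quot i j \<otimes> quot k l = s i \<otimes> s (k - 1) \<otimes> inv (s l \<otimes> s (j - 1))" for i j k l
    using inv_s_mult[of "j - 1" k]
    by (simp add: quot_def inv_mult_group m_assoc) (simp add: m_assoc[symmetric])
  have "s i \<otimes> s (k - 1) = s k \<otimes> s (i - 1)" "s l \<otimes> s (j - 1) = s j \<otimes> s (l - 1)"
    using s_swap[of i "k - 1"] s_swap[of l "j - 1"] by simp_all
  then show ?thesis
    unfolding gen by simp
qed

lemma quots_commute:
  assumes "d \<in> quots" "e \<in> quots"
  shows "d \<otimes> e = e \<otimes> d"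
proof -
  \<comment> \<open>The centralizer of \<open>a\<close> is closed under inverses and products, so
    commutation extends from generators, first in \<open>d\<close> and then in
    \<open>e\<close>.\<close>
  have comm_inv: "inv b \<otimes> a = a \<otimes> inv b"
    if "a \<in> carrier G" "b \<in> carrier G" "b \<otimes> a = a \<otimes> b" for a b
    using that by (metis inv_closed inv_solve_left inv_solve_right m_assoc m_closed)
  have comm_mult: "(b \<otimes> b') \<otimes> a = a \<otimes> (b \<otimes> b')"
    if "a \<in> carrier G" "b \<in> carrier G" "b' \<in> carrier G" "b \<otimes> a = a \<otimes> b" "b' \<otimes> a = a \<otimes> b'" for a b b'
    using that by (metis m_assoc)
  have 1: "d \<otimes> quot i j = quot i j \<otimes> d" for i j
    using assms(1) unfolding quots_def
  proof induction
    case (eng a b)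
    then show ?case
      using quots_closed unfolding quots_def by (intro comm_mult) auto
  qed (auto simp: quot_commute intro!: comm_inv)
  have dc: "d \<in> carrier G"
    using assms quots_closed by simp
  have "e \<otimes> d = d \<otimes> e"
    using assms(2) unfolding quots_def
  proof induction
    case (eng a b)
    then show ?case
      using quots_closed dc unfolding quots_def by (intro comm_mult) auto
  qed (auto simp: 1 dc intro!: comm_inv)
  then show ?thesis by simp
qed

section \<open>Conjugation by \<open>s 0\<close> and the resulting factorizations\<close>

lemma s0_mult_quot: "s 0 \<otimes> quot i j = quot (i + 1) (j + 1) \<otimes> s 0"
proof -
  have "s 0 \<otimes> quot i j = s (i + 1) \<otimes> (s (- 1) \<otimes> inv s j)"
    using s_swap[of 0 i] by (simp add: quot_def m_assoc[symmetric])
  \<comment> \<open>The factor \<open>s (- 1)\<close> produced by moving \<open>s 0\<close> past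
    \<open>s i\<close> turns back into \<open>s 0\<close>.\<close>
  also have "s (- 1) \<otimes> inv s j = inv s (j + 1) \<otimes> s 0"
    using inv_s_mult[of j 0] by simp
  finally show ?thesis
    by (simp add: quot_def m_assoc)
qed

lemma pow_mult_quot: "s 0 [^] k \<otimes> quot i j = quot (i + k) (j + k) \<otimes> s 0 [^] (k :: int)"
proof (induction k rule: int_induct[where k = 0])
  case (step1 k)
  have pow: "s 0 [^] (k + 1) = s 0 \<otimes> s 0 [^] k"
    using int_pow_mult[of "s 0" 1 k] by (simp add: int_pow_1 add.commute)
  then have "s 0 [^] (k + 1) \<otimes> quot i j = s 0 \<otimes> (s 0 [^] k \<otimes> quot i j)"
    by (simp add: m_assoc)
  also have "\<dots> = (s 0 \<otimes> quot (i + k) (j + k)) \<otimes> s 0 [^] k"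
    using step1 by (simp add: m_assoc)
  also have "\<dots> = quot (i + (k + 1)) (j + (k + 1)) \<otimes> (s 0 \<otimes> s 0 [^] k)"
    by (simp add: s0_mult_quot m_assoc add.assoc)
  finally show ?case
    using pow by simp
next
  case (step2 k)
  have pow: "s 0 [^] k = s 0 \<otimes> s 0 [^] (k - 1)"
    using int_pow_mult[of "s 0" 1 "k - 1"] by (simp add: int_pow_1)
  \<comment> \<open>For the downward step, the claim for \<open>k - 1\<close> multiplied by
    \<open>s 0\<close> on the left is the claim for \<open>k\<close>; then \<open>s 0\<close>
    cancels.\<close>
  have "s 0 \<otimes> (s 0 [^] (k - 1) \<otimes> quot i j) = s 0 [^] k \<otimes> quot i j"
    by (simp add: pow m_assoc)
  also have "\<dots> = quot (i + k) (j + k) \<otimes> s 0 \<otimes> s 0 [^] (k - 1)"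
    using step2 by (simp add: pow m_assoc)
  also have "\<dots> = s 0 \<otimes> (quot (i + (k - 1)) (j + (k - 1)) \<otimes> s 0 [^] (k - 1))"
    using s0_mult_quot[of "i + (k - 1)" "j + (k - 1)"] by (simp add: m_assoc[symmetric])
  finally show ?case
    by simp
qed simp

text \<open>Powers of \<open>s 0\<close> normalize \<open>quots\<close>, since by
  \<open>pow_mult_quot\<close> they conjugate generators to generators.\<close>

lemma pow_mult_quots:
  assumes "d \<in> quots"
  shows "\<exists>d' \<in> quots. s 0 [^] (k :: int) \<otimes> d = d' \<otimes> s 0 [^] k"
  using assms unfolding quots_def
proof induction
  case one
  then show ?case by (auto intro: bexI[OF _ generate.one])
next
  case (incl h)
  then show ?case using pow_mult_quot quot_in_quots unfolding quots_def by blast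
next
  case (inv h)
  then show ?case
    using pow_mult_quot quot_in_quots inv_quot unfolding quots_def by fastforce
next
  case (eng a b)
  then obtain a' b' where a': "a' \<in> quots" "s 0 [^] k \<otimes> a = a' \<otimes> s 0 [^] k"
    and b': "b' \<in> quots" "s 0 [^] k \<otimes> b = b' \<otimes> s 0 [^] k"
    unfolding quots_def by blast
  have c: "a \<in> carrier G" "b \<in> carrier G" "a' \<in> carrier G" "b' \<in> carrier G"
    using eng a' b' quots_closed unfolding quots_def by auto
  have "s 0 [^] k \<otimes> (a \<otimes> b) = a' \<otimes> b' \<otimes> s 0 [^] k"
    using a'(2) b'(2) c by (metis int_pow_closed m_assoc s_closed)
  moreover have "a' \<otimes> b' \<in> quots"
    using a' b' by (simp add: subgroup.m_closed[OF subgroup_quots])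
  ultimately show ?case unfolding quots_def by blast
qed

lemma generate_range_eq_quots_mult_pow:
  assumes "g \<in> generate G (range s)"
  obtains d and k :: int where "d \<in> quots" "g = d \<otimes> s 0 [^] k"
proof -
  have "\<exists>d\<in>quots. \<exists>k::int. g = d \<otimes> s 0 [^] k"
    using assms
  proof induction
    case one
    show ?case
      by (rule bexI[of _ \<one>], rule exI[of _ 0]) (auto simp: subgroup.one_closed[OF subgroup_quots])
  next
    case (incl h)
    then obtain i where "h = s i" by auto
    then have "h = quot i 0 \<otimes> s 0 [^] (1 :: int)"
      by (simp add: quot_def m_assoc int_pow_1)
    then show ?case by blast
  next
    case (inv h)
    then obtain i where "h = s i" by auto
    moreover have "inv s i = inv s 0 \<otimes> quot 0 i"
      by (simp add: quot_def m_assoc[symmetric])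
    \<comment> \<open>\<open>inv s 0\<close> is moved to the right of \<open>quot 0 i\<close>, which
      lowers both indices by one.\<close>
    ultimately have "h = s i" "inv s i = quot (- 1) (i - 1) \<otimes> s 0 [^] (- 1 :: int)"
      using \<open>h = s i\<close> pow_mult_quot[of "-1" 0 i] by (simp_all add: int_pow_neg int_pow_1)
    then show ?case by blast
  next
    case (eng a b)
    then obtain d e k l where d: "d \<in> quots" "a = d \<otimes> s 0 [^] (k :: int)"
      and e: "e \<in> quots" "b = e \<otimes> s 0 [^] (l :: int)" by blast
    obtain e' where e': "e' \<in> quots" "s 0 [^] k \<otimes> e = e' \<otimes> s 0 [^] k"
      using pow_mult_quots e by blast
    have "a \<otimes> b = d \<otimes> (s 0 [^] k \<otimes> e) \<otimes> s 0 [^] l"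
      using d e quots_closed by (simp add: m_assoc)
    also have "\<dots> = d \<otimes> e' \<otimes> s 0 [^] (k + l)"
      using d e' quots_closed by (simp add: m_assoc int_pow_mult)
    finally show ?case
      using d e' subgroup.m_closed[OF subgroup_quots] by blast
  qed
  then show thesis using that by blast
qed

text \<open>The previous factorization of \<open>inv g\<close>, inverted. This order of the factors
  yields the coordinates of a point of \<open>X\<close>.\<close>

lemma generate_range_eq_pow_mult_quots:
  assumes "g \<in> generate G (range s)"
  obtains d and k :: int where "d \<in> quots" "g = s 0 [^] k \<otimes> d"
proof -
  have "inv g \<in> generate G (range s)"
    using assms by (intro generate_m_inv_closed) auto
  then obtain d and k :: int where d: "d \<in> quots" "inv g = d \<otimes> s 0 [^] k"
    using generate_range_eq_quots_mult_pow by metis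
  have "g \<in> carrier G"
    using assms generate_in_carrier[of "range s"] by auto
  then have "g = s 0 [^] (- k) \<otimes> inv d"
    using d quots_closed by (metis int_pow_closed int_pow_neg inv_inv inv_mult_group s_closed)
  then show thesis
    using that d subgroup.m_inv_closed[OF subgroup_quots] by blast
qed

end

section \<open>The cyclic factor\<close>

text \<open>The value 0 at \<infinity> fits \<open>k mod 0 = k\<close>, divisibility by 0, and the
  convention that \<open>ord\<close> is 0 for infinite order.\<close>

definition modulus :: "enat \<Rightarrow> int" where
  "modulus n = (case n of enat m \<Rightarrow> int m | \<infinity> \<Rightarrow> 0)"

lemma zclass_eq_mod: "zclass n k = k mod modulus n"
  by (simp add: zclass_def modulus_def split: enat.split)

lemma zclass_eq_iff: "zclass n k = zclass n l \<longleftrightarrow> modulus n dvd k - l"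
  by (simp add: zclass_eq_mod mod_eq_dvd_iff)

lemma carrier_Z_group: "carrier (Z_group n) = range (zclass n)"
proof -
  have "carrier (Z_group n) \<subseteq> range (zclass n)"
    using zclass_id by (metis rangeI subsetI)
  then show ?thesis
    using zclass_hom by (auto simp: hom_def)
qed

lemma zclass_closed [simp, intro]: "zclass n k \<in> carrier (Z_group n)"
  by (simp add: carrier_Z_group)

text \<open>As \<open>u\<close> runs through \<open>m\<close> consecutive integers,
  \<open>a - u\<close> meets each residue once, so the product does not depend on
  \<open>a\<close>.\<close>

lemma (in comm_group) finprod_full_cycle:
  fixes a :: int and m :: nat
  assumes "m > 0" "c \<in> {0..<int m} \<rightarrow> carrier G"
  shows "finprod G (\<lambda>u. c ((a - int u) mod int m)) {..<m} = finprod G c {0..<int m}"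
proof -
  let ?h = "\<lambda>u. (a - int u) mod int m"
  have inj: "inj_on ?h {..<m}"
  proof (rule inj_onI)
    fix u v assume "u \<in> {..<m}" "v \<in> {..<m}" "?h u = ?h v"
    then have "int m dvd int v - int u" "\<bar>int v - int u\<bar> < int m"
      by (auto simp: mod_eq_dvd_iff)
    then show "u = v"
      using dvd_imp_le_int[of "int v - int u" "int m"] by auto
  qed
  have "?h ` {..<m} = {0..<int m}"
    by (rule card_subset_eq) (use assms(1) card_image[OF inj] in auto)
  then show ?thesis
    using finprod_reindex[of c ?h "{..<m}"] inj assms(2) by simp
qed

section \<open>Solutions of multipermutation level at most two\<close>

lemma BijGroup_closed: "g \<in> carrier (BijGroup S) \<Longrightarrow> x \<in> S \<Longrightarrow> g x \<in> S"
  by (auto simp: BijGroup_def Bij_def dest: bij_betwE)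

lemma BijGroup_mult_apply:
  "g \<in> carrier (BijGroup S) \<Longrightarrow> h \<in> carrier (BijGroup S) \<Longrightarrow> x \<in> S \<Longrightarrow>
    (g \<otimes>\<^bsub>BijGroup S\<^esub> h) x = g (h x)"
  by (simp add: BijGroup_def compose_def)

lemma BijGroup_one_apply: "x \<in> S \<Longrightarrow> \<one>\<^bsub>BijGroup S\<^esub> x = x"
  by (simp add: BijGroup_def)

lemma BijGroup_inv_apply:
  assumes "g \<in> carrier (BijGroup S)" "x \<in> S"
  shows "g ((inv\<^bsub>BijGroup S\<^esub> g) x) = x" "(inv\<^bsub>BijGroup S\<^esub> g) (g x) = x"
proof -
  interpret group "BijGroup S" by (rule group_BijGroup)
  show "g ((inv\<^bsub>BijGroup S\<^esub> g) x) = x" "(inv\<^bsub>BijGroup S\<^esub> g) (g x) = x"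
    using BijGroup_mult_apply[OF _ _ assms(2)] BijGroup_one_apply[OF assms(2)] assms(1)
    by (metis inv_closed r_inv, metis inv_closed l_inv)
qed

lemma BijGroup_eqI:
  assumes "g \<in> carrier (BijGroup S)" "h \<in> carrier (BijGroup S)" "\<And>x. x \<in> S \<Longrightarrow> g x = h x"
  shows "g = h"
  using assms by (auto simp: BijGroup_def Bij_def intro: extensionalityI)

context ybe_solution
begin

lemma sigma_perm_closed [simp, intro]: "x \<in> carrier X \<Longrightarrow> sigma_perm X x \<in> carrier (BijGroup (carrier X))"
  using bij_sigma by (simp add: BijGroup_def Bij_def sigma_perm_def)

lemma sigma_perm_apply [simp]: "y \<in> carrier X \<Longrightarrow> sigma_perm X x y = sigma X x y"
  by (simp add: sigma_perm_def)

lemma sigma_perm_eq: "(x, y) \<in> ret_rel X \<Longrightarrow> sigma_perm X x = sigma_perm X y"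
  using ret_rel_sigma by (auto simp: sigma_perm_def)

lemma sigma_perm_mult:
  assumes "x \<in> carrier X" "y \<in> carrier X"
  shows "sigma_perm X x \<otimes>\<^bsub>BijGroup (carrier X)\<^esub> sigma_perm X y
    = sigma_perm X (sigma X x y) \<otimes>\<^bsub>BijGroup (carrier X)\<^esub> sigma_perm X (tau X y x)"
proof -
  interpret B: group "BijGroup (carrier X)" by (rule group_BijGroup)
  show ?thesis
  proof (rule BijGroup_eqI)
    fix w assume "w \<in> carrier X"
    then show "(sigma_perm X x \<otimes>\<^bsub>BijGroup (carrier X)\<^esub> sigma_perm X y) w
      = (sigma_perm X (sigma X x y) \<otimes>\<^bsub>BijGroup (carrier X)\<^esub> sigma_perm X (tau X y x)) w"
      using braid_sigma[of x y w] assms by (simp add: BijGroup_mult_apply)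
  qed (use assms in auto)
qed

end

text \<open>\<open>level_tau\<close> is the form that both level cases share, so levels 1 and 2 need
  no further distinction.\<close>

locale level2_solution = ybe_solution X for X :: "'a ybe" +
  fixes z :: 'a
  assumes z [simp, intro]: "z \<in> carrier X"
    and level_tau: "\<And>x y w. x \<in> carrier X \<Longrightarrow> y \<in> carrier X \<Longrightarrow> w \<in> carrier X \<Longrightarrow>
      (tau X x w, tau X y w) \<in> ret_rel X"
    and transitive: "\<And>x. x \<in> carrier X \<Longrightarrow> \<exists>g \<in> carrier (perm_group X). g z = x"
begin

abbreviation B where "B \<equiv> BijGroup (carrier X)"

definition p :: "'a \<Rightarrow> 'a" where "p = sigma_perm X z"

text \<open>Modulo \<open>ret_rel\<close> every point is some power of \<open>p\<close> applied to
  \<open>z\<close>, so these are all the permutations \<sigma>; see \<open>range_s\<close>.\<close>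

definition s :: "int \<Rightarrow> 'a \<Rightarrow> 'a" where "s k = sigma_perm X ((p [^]\<^bsub>B\<^esub> k) z)"

interpretation B: group B by (rule group_BijGroup)

lemma p_closed [simp, intro]: "p \<in> carrier B"
  by (simp add: p_def)

lemma pow_p_apply_closed [simp, intro]: "x \<in> carrier X \<Longrightarrow> (p [^]\<^bsub>B\<^esub> (k :: int)) x \<in> carrier X"
  using BijGroup_closed[of "p [^]\<^bsub>B\<^esub> k"] by simp

section \<open>The common permutation induced on the retraction\<close>

lemma level_tau':
  assumes "x \<in> carrier X" "x' \<in> carrier X" "(y, y') \<in> ret_rel X"
  shows "(tau X x y, tau X x' y') \<in> ret_rel X"
  using level_tau[OF assms(1,2), of y] tau_respects_ret_rel[OF assms(3,2)] ret_rel_trans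
    ret_rel_carrier[OF assms(3)] by blast

text \<open>By \<open>tau_tau_sigma\<close>, maps \<tau> send the two values to \<open>y\<close> and
  \<open>y'\<close>. The index of \<tau> is immaterial modulo \<open>ret_rel\<close>, and
  \<open>tau_reflects_ret_rel\<close> pulls the relation back.\<close>

lemma level_sigma:
  assumes "x \<in> carrier X" "x' \<in> carrier X" "(y, y') \<in> ret_rel X"
  shows "(sigma X x y, sigma X x' y') \<in> ret_rel X"
proof (rule tau_reflects_ret_rel)
  have y: "y \<in> carrier X" "y' \<in> carrier X"
    using ret_rel_carrier[OF assms(3)] by auto
  show "tau X y x \<in> carrier X" "sigma X x y \<in> carrier X" "sigma X x' y' \<in> carrier X"
    using assms y by auto
  have "(tau X (tau X y x) (sigma X x' y'), tau X (tau X y' x') (sigma X x' y')) \<in> ret_rel X"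
    using level_tau assms y by simp
  then show "(tau X (tau X y x) (sigma X x y), tau X (tau X y x) (sigma X x' y')) \<in> ret_rel X"
    using assms y by (simp add: tau_tau_sigma) (meson ret_rel_sym ret_rel_trans)
qed

text \<open>A map \<tau> recovers \<open>y\<close> from \<open>sigma X x y\<close>, and these maps
  respect classes whatever their index. This makes the inverses of \<sigma> act on the retraction
  too.\<close>

lemma level_sigma_cancel:
  assumes "x \<in> carrier X" "x' \<in> carrier X" "y \<in> carrier X" "y' \<in> carrier X"
    and "(sigma X x y, sigma X x' y') \<in> ret_rel X"
  shows "(y, y') \<in> ret_rel X"
  using level_tau'[of "tau X y x" "tau X y' x'", OF _ _ assms(5)] assms(1-4)
  by (simp add: tau_tau_sigma)

text \<open>
  By \<open>level_sigma\<close>, all \<open>sigma X x\<close> induce the same permutation of the retraction;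
  \<open>shifts g k\<close> says that \<open>g\<close> induces its \<open>k\<close>-th power.
\<close>

definition shifts :: "('a \<Rightarrow> 'a) \<Rightarrow> int \<Rightarrow> bool" where
  "shifts g k \<longleftrightarrow> g \<in> carrier B \<and> (\<forall>(y, y') \<in> ret_rel X. (g y, (p [^]\<^bsub>B\<^esub> k) y') \<in> ret_rel X)"

lemma shiftsD: "shifts g k \<Longrightarrow> (y, y') \<in> ret_rel X \<Longrightarrow> (g y, (p [^]\<^bsub>B\<^esub> k) y') \<in> ret_rel X"
  by (auto simp: shifts_def)

lemma shiftsI:
  assumes "g \<in> carrier B"
    and "\<And>y y'. y \<in> carrier X \<Longrightarrow> y' \<in> carrier X \<Longrightarrow> (y, y') \<in> ret_rel X \<Longrightarrow>
      (g y, (p [^]\<^bsub>B\<^esub> k) y') \<in> ret_rel X"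
  shows "shifts g k"
  using assms ret_rel_carrier by (force simp: shifts_def)

lemma shifts_closed: "shifts g k \<Longrightarrow> g \<in> carrier B"
  by (simp add: shifts_def)

lemma shifts_one: "shifts \<one>\<^bsub>B\<^esub> 0"
  by (rule shiftsI) (auto simp: BijGroup_one_apply)

lemma shifts_mult:
  assumes "shifts g k" "shifts h l"
  shows "shifts (g \<otimes>\<^bsub>B\<^esub> h) (k + l)"
proof (rule shiftsI)
  have c: "g \<in> carrier B" "h \<in> carrier B"
    using assms shifts_closed by auto
  then show "g \<otimes>\<^bsub>B\<^esub> h \<in> carrier B"
    by simp
  fix y y' assume "y \<in> carrier X" "y' \<in> carrier X" "(y, y') \<in> ret_rel X"
  then show "((g \<otimes>\<^bsub>B\<^esub> h) y, (p [^]\<^bsub>B\<^esub> (k + l)) y') \<in> ret_rel X"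
    using shiftsD[OF assms(1) shiftsD[OF assms(2)]] c by (simp add: BijGroup_mult_apply B.int_pow_mult)
qed

lemma shifts_sigma: "x \<in> carrier X \<Longrightarrow> shifts (sigma_perm X x) 1"
  by (rule shiftsI) (use level_sigma in \<open>auto simp: B.int_pow_1 p_def\<close>)

lemma shifts_inv_sigma:
  assumes "x \<in> carrier X"
  shows "shifts (inv\<^bsub>B\<^esub> (sigma_perm X x)) (- 1)"
proof -
  have "((inv\<^bsub>B\<^esub> (sigma_perm X x)) y, (inv\<^bsub>B\<^esub> p) y') \<in> ret_rel X" if "(y, y') \<in> ret_rel X" for y y'
  proof -
    have y: "y \<in> carrier X" "y' \<in> carrier X"
      using ret_rel_carrier[OF that] by auto
    then have c: "(inv\<^bsub>B\<^esub> (sigma_perm X x)) y \<in> carrier X" "(inv\<^bsub>B\<^esub> p) y' \<in> carrier X"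
      using assms by (simp_all add: BijGroup_closed)
    have "sigma X x ((inv\<^bsub>B\<^esub> (sigma_perm X x)) y) = y" "sigma X z ((inv\<^bsub>B\<^esub> p) y') = y'"
      using BijGroup_inv_apply(1)[of "sigma_perm X x" "carrier X" y]
        BijGroup_inv_apply(1)[of p "carrier X" y'] c y assms by (auto simp: p_def)
    then show ?thesis
      using level_sigma_cancel[OF assms z c] that by simp
  qed
  then show ?thesis
    using assms by (auto simp: shifts_def B.int_pow_neg B.int_pow_1)
qed

lemma shifts_pow: "shifts (p [^]\<^bsub>B\<^esub> k) k"
proof (induction k rule: int_induct[where k = 0])
  case base
  then show ?case using shifts_one by simp
next
  case (step1 k)
  then show ?case
    using shifts_mult[OF _ shifts_sigma[OF z]] by (fastforce simp: B.int_pow_mult B.int_pow_1 p_def)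
next
  case (step2 k)
  then show ?case
    using shifts_mult[OF step2(2) shifts_inv_sigma[OF z]] B.int_pow_mult[of p k "-1"]
    by (simp add: B.int_pow_neg B.int_pow_1 p_def)
qed

lemma s_eq:
  assumes "shifts g k"
  shows "sigma_perm X (g z) = s k"
  unfolding s_def by (rule sigma_perm_eq[OF shiftsD[OF assms ret_rel_refl[OF z]]])

lemma s_0 [simp]: "s 0 = p"
  by (simp add: s_def p_def BijGroup_one_apply)

text \<open>Let \<open>x\<close>, \<open>y\<close> be the points with exponents \<open>i\<close>,
  \<open>j\<close>. Then \<open>sigma X x y\<close> has exponent \<open>j + 1\<close>. By
  \<open>sigma_sigma_tau\<close>, \<open>tau X y x\<close> is the preimage of \<open>x\<close> under
  \<sigma> at that point, so it has exponent \<open>i - 1\<close>. Thus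
  \<open>sigma_perm_mult\<close> becomes \<open>s_swap\<close>.\<close>

sublocale shift_family B s
proof (unfold_locales)
  fix i j :: int
  let ?x = "(p [^]\<^bsub>B\<^esub> i) z" and ?y = "(p [^]\<^bsub>B\<^esub> j) z"
  have c: "?x \<in> carrier X" "?y \<in> carrier X"
    by simp_all
  have s_closed: "s l \<in> carrier B" for l
    by (simp add: s_def)
  then show "s i \<in> carrier B" .
  have "sigma_perm X (sigma X ?x ?y) = s (j + 1)"
    using s_eq[OF shifts_mult[OF shifts_sigma[OF c(1)] shifts_pow[of j]]] c
    by (simp add: BijGroup_mult_apply add.commute)
  moreover have "tau X ?y ?x = (inv\<^bsub>B\<^esub> (sigma_perm X (sigma X ?x ?y))) ?x"
    using BijGroup_inv_apply(2)[of "sigma_perm X (sigma X ?x ?y)" "carrier X" "tau X ?y ?x"] c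
    by (simp add: sigma_sigma_tau)
  moreover have "shifts (inv\<^bsub>B\<^esub> (sigma_perm X (sigma X ?x ?y)) \<otimes>\<^bsub>B\<^esub> p [^]\<^bsub>B\<^esub> i) (- 1 + i)"
    using shifts_mult[OF shifts_inv_sigma shifts_pow] c by simp
  ultimately have "sigma_perm X (tau X ?y ?x) = s (i - 1)"
    using s_eq[of "inv\<^bsub>B\<^esub> (sigma_perm X (sigma X ?x ?y)) \<otimes>\<^bsub>B\<^esub> p [^]\<^bsub>B\<^esub> i" "- 1 + i"] c s_closed[of "j + 1"]
    by (simp add: BijGroup_mult_apply)
  then show "s i \<otimes>\<^bsub>B\<^esub> s j = s (j + 1) \<otimes>\<^bsub>B\<^esub> s (i - 1)"
    using sigma_perm_mult[OF c] \<open>sigma_perm X (sigma X ?x ?y) = s (j + 1)\<close> by (simp add: s_def)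
qed

section \<open>Generators of the permutation group and the displacement group\<close>

lemma carrier_perm_group: "carrier (perm_group X) = generate B (sigma_perm X ` carrier X)"
  unfolding perm_group_def carrier_subgroup_generated
  by (rule arg_cong[where f = "generate B"]) auto

lemma perm_group_shifts:
  assumes "g \<in> carrier (perm_group X)"
  shows "\<exists>k. shifts g k"
  using assms unfolding carrier_perm_group
proof induction
  case one
  show ?case using shifts_one by blast
next
  case (incl h)
  then show ?case using shifts_sigma by blast
next
  case (inv h)
  then show ?case using shifts_inv_sigma by blast
next
  case (eng g h)
  then show ?case using shifts_mult by blast
qed

text \<open>By transitivity each point is \<open>g z\<close> for some \<open>g\<close> that shifts
  by some \<open>k\<close>, and \<open>s_eq\<close> applies.\<close>

lemma range_s: "sigma_perm X ` carrier X = range s"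
proof
  show "sigma_perm X ` carrier X \<subseteq> range s"
    using transitive perm_group_shifts s_eq by fastforce
  show "range s \<subseteq> sigma_perm X ` carrier X"
    unfolding s_def by auto
qed

lemma carrier_perm_group': "carrier (perm_group X) = generate B (range s)"
  by (simp add: carrier_perm_group range_s)

lemma carrier_dis_group: "carrier (dis_group X) = quots"
proof -
  have "{sigma_perm X x \<otimes>\<^bsub>B\<^esub> inv\<^bsub>B\<^esub> (sigma_perm X y) | x y. x \<in> carrier X \<and> y \<in> carrier X}
      = {g \<otimes>\<^bsub>B\<^esub> inv\<^bsub>B\<^esub> h | g h. g \<in> sigma_perm X ` carrier X \<and> h \<in> sigma_perm X ` carrier X}"
    by blast
  also have "\<dots> = {quot i j | i j. True}"
    unfolding range_s quot_def by blast
  finally show ?thesis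
    unfolding dis_group_def carrier_subgroup_generated quots_def
    by (auto intro!: arg_cong[where f = "generate B"])
qed

text \<open>The shifts 1 and -1 of the factors of a generator cancel. Hence \<sigma> at
  \<open>(p [^] i) (d z)\<close> depends on \<open>i\<close> only.\<close>

lemma quots_shifts:
  assumes "d \<in> quots"
  shows "shifts d 0"
proof -
  have s: "\<exists>x \<in> carrier X. s i = sigma_perm X x" for i
    unfolding s_def by auto
  have "shifts (quot i j) 0" for i j
    using shifts_mult[OF shifts_sigma shifts_inv_sigma] s[of i] s[of j]
    unfolding quot_def by fastforce
  with assms show ?thesis
    unfolding quots_def
  proof induction
    case (eng a b)
    then show ?case using shifts_mult[of a 0 b 0] by simp
  qed (auto simp: shifts_one inv_quot)
qed

text \<open>The quotient of \<open>quots\<close> by its stabilizer of \<open>z\<close>, carried by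
  the orbit itself so that its elements have the type of the points. It serves as G.\<close>

definition orbit_group :: "'a monoid" where
  "orbit_group = \<lparr>carrier = (\<lambda>d. d z) ` quots,
     mult = (\<lambda>x y. (SOME d. d \<in> quots \<and> d z = x) y), one = z\<rparr>"

lemma orbit_group_one: "\<one>\<^bsub>orbit_group\<^esub> = z"
  by (simp add: orbit_group_def)

lemma quots_apply_closed [simp]: "d \<in> quots \<Longrightarrow> x \<in> carrier X \<Longrightarrow> d x \<in> carrier X"
  by (rule BijGroup_closed[OF quots_closed])

text \<open>
  Since \<open>quots\<close> is abelian, an element fixing \<open>z\<close> fixes the whole orbit of \<open>z\<close>, so the choice
  of \<open>d\<close> in the multiplication of \<open>orbit_group\<close> is immaterial.
\<close>

lemma orbit_group_mult:
  assumes "d \<in> quots" "e \<in> quots"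
  shows "d z \<otimes>\<^bsub>orbit_group\<^esub> e z = (d \<otimes>\<^bsub>B\<^esub> e) z"
proof -
  define d' where "d' = (SOME d'. d' \<in> quots \<and> d' z = d z)"
  have d': "d' \<in> quots" "d' z = d z"
    using someI[of "\<lambda>d'. d' \<in> quots \<and> d' z = d z" d] assms by (simp_all add: d'_def)
  have swap: "f (e z) = e (f z)" if "f \<in> quots" for f
    using arg_cong[OF quots_commute[OF that assms(2)], of "\<lambda>g. g z"]
      quots_closed[OF that] quots_closed[OF assms(2)] by (simp add: BijGroup_mult_apply)
  have "d z \<otimes>\<^bsub>orbit_group\<^esub> e z = d' (e z)"
    by (simp add: orbit_group_def d'_def)
  also have "\<dots> = d (e z)"
    using swap[OF d'(1)] swap[OF assms(1)] d'(2) by simp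
  finally show ?thesis
    using quots_closed assms by (simp add: BijGroup_mult_apply)
qed

lemma comm_group_dis_group: "comm_group (dis_group X)"
proof -
  have "group (dis_group X)"
    unfolding dis_group_def by (rule B.group_subgroup_generated)
  moreover have "\<And>x y. x \<in> carrier (dis_group X) \<Longrightarrow> y \<in> carrier (dis_group X) \<Longrightarrow>
      x \<otimes>\<^bsub>dis_group X\<^esub> y = y \<otimes>\<^bsub>dis_group X\<^esub> x"
    using quots_commute by (simp add: carrier_dis_group) (simp add: dis_group_def)
  ultimately show ?thesis
    by (rule group.group_comm_groupI)
qed

lemma orbit_hom: "(\<lambda>d. d z) \<in> hom (dis_group X) orbit_group"
  unfolding hom_def carrier_dis_group
  using orbit_group_mult by (auto simp: orbit_group_def dis_group_def)

lemma comm_group_orbit_group: "comm_group orbit_group"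
proof -
  interpret D: comm_group "dis_group X" by (rule comm_group_dis_group)
  \<comment> \<open>\<open>hom_imp_img_comm_group\<close> overwrites carrier and unit of the target;
    here both are unchanged.\<close>
  have "orbit_group\<lparr>carrier := (\<lambda>d. d z) ` carrier (dis_group X), one := \<one>\<^bsub>dis_group X\<^esub> z\<rparr> = orbit_group"
    by (simp add: orbit_group_def carrier_dis_group) (simp add: dis_group_def BijGroup_one_apply)
  then show ?thesis
    using D.hom_imp_img_comm_group[OF orbit_hom] by simp
qed

lemma orbit_group_inv:
  assumes "d \<in> quots"
  shows "inv\<^bsub>orbit_group\<^esub> (d z) = (inv\<^bsub>B\<^esub> d) z"
proof -
  interpret O: comm_group orbit_group by (rule comm_group_orbit_group)
  have d: "inv\<^bsub>B\<^esub> d \<in> quots"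
    using assms subgroup.m_inv_closed[OF subgroup_quots] by simp
  have "(inv\<^bsub>B\<^esub> d) z \<otimes>\<^bsub>orbit_group\<^esub> d z = \<one>\<^bsub>orbit_group\<^esub>"
    using orbit_group_mult[OF d assms] quots_closed[OF assms]
    by (simp add: BijGroup_one_apply) (simp add: orbit_group_def)
  then show ?thesis
    using O.inv_equality d assms by (simp add: orbit_group_def)
qed

section \<open>Coordinates on \<open>X\<close> from the orbit of \<open>z\<close> and the powers of
  \<open>p\<close>\<close>

lemma pow_p_quots_decomp:
  assumes "x \<in> carrier X"
  obtains d and k :: int where "d \<in> quots" "x = (p [^]\<^bsub>B\<^esub> k) (d z)"
proof -
  obtain g where g: "g \<in> carrier (perm_group X)" "g z = x"
    using transitive[OF assms] by blast
  obtain d and k :: int where d: "d \<in> quots" "g = p [^]\<^bsub>B\<^esub> k \<otimes>\<^bsub>B\<^esub> d"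
    using generate_range_eq_pow_mult_quots[of g] g(1) unfolding carrier_perm_group' s_0 by blast
  then have "x = (p [^]\<^bsub>B\<^esub> k) (d z)"
    using g(2) quots_closed by (simp add: BijGroup_mult_apply)
  then show thesis
    using that d by blast
qed

lemma quots_in_perm_group: "d \<in> quots \<Longrightarrow> d \<in> carrier (perm_group X)"
proof -
  have sub: "subgroup (generate B (range s)) B"
    by (rule B.generate_is_subgroup) auto
  have "quots \<subseteq> generate B (range s)"
    unfolding quots_def
  proof (rule B.generate_subgroup_incl[OF _ sub])
    have "s i \<in> generate B (range s)" for i
      by (rule generate.incl) simp
    then show "{quot i j |i j. True} \<subseteq> generate B (range s)"
      unfolding quot_def
      by (auto intro!: subgroup.m_closed[OF sub] subgroup.m_inv_closed[OF sub])
  qed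
  then show "d \<in> quots \<Longrightarrow> d \<in> carrier (perm_group X)"
    unfolding carrier_perm_group' by blast
qed

lemma pow_p_in_perm_group: "p [^]\<^bsub>B\<^esub> (k :: int) \<in> carrier (perm_group X)"
proof -
  have sub: "subgroup (generate B (range s)) B"
    by (rule B.generate_is_subgroup) auto
  have "s 0 \<in> generate B (range s)"
    by (rule generate.incl) (rule rangeI)
  then have "p \<in> generate B (range s)"
    by simp
  then show ?thesis
    unfolding carrier_perm_group' by (rule B.subgroup_int_pow_closed[OF sub])
qed

text \<open>The element \<open>g\<close> below fixes \<open>z\<close>, so \<open>stab\<close> puts
  it into \<open>quots\<close>. Then the power of \<open>p\<close> with exponent
  \<open>k - l\<close> lies in \<open>quots\<close> as well, and \<open>triv\<close> makes it the
  identity.\<close>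

lemma pow_p_quots_inject:
  fixes k l :: int
  assumes triv: "quots \<inter> range (\<lambda>k::int. p [^]\<^bsub>B\<^esub> k) = {\<one>\<^bsub>B\<^esub>}"
    and stab: "stabilizer (perm_group X) (\<lambda>g. g) z \<subseteq> quots"
    and d: "d \<in> quots" and e: "e \<in> quots"
    and eq: "(p [^]\<^bsub>B\<^esub> k) (d z) = (p [^]\<^bsub>B\<^esub> l) (e z)"
  shows "p [^]\<^bsub>B\<^esub> k = p [^]\<^bsub>B\<^esub> l" "d z = e z"
proof -
  have c: "d \<in> carrier B" "e \<in> carrier B"
    using d e quots_closed by auto
  define g where "g = inv\<^bsub>B\<^esub> e \<otimes>\<^bsub>B\<^esub> (p [^]\<^bsub>B\<^esub> (k - l) \<otimes>\<^bsub>B\<^esub> d)"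
  have sub: "subgroup (generate B (range s)) B"
    by (rule B.generate_is_subgroup) auto
  have "g \<in> carrier (perm_group X)"
    using quots_in_perm_group[OF d] quots_in_perm_group[OF e] pow_p_in_perm_group[of "k - l"]
      subgroup.m_closed[OF sub] subgroup.m_inv_closed[OF sub]
    unfolding g_def carrier_perm_group' by simp
  moreover have "g z = z"
  proof -
    have "(p [^]\<^bsub>B\<^esub> (k - l)) (d z) = (p [^]\<^bsub>B\<^esub> (- l)) ((p [^]\<^bsub>B\<^esub> k) (d z))"
      using B.int_pow_mult[of p "- l" k] d
        BijGroup_mult_apply[of "p [^]\<^bsub>B\<^esub> (- l)" "carrier X" "p [^]\<^bsub>B\<^esub> k" "d z"] by simp
    also have "\<dots> = (p [^]\<^bsub>B\<^esub> (- l)) ((p [^]\<^bsub>B\<^esub> l) (e z))"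
      by (simp add: eq)
    also have "\<dots> = e z"
      using BijGroup_inv_apply(2)[of "p [^]\<^bsub>B\<^esub> l" "carrier X" "e z"] e by (simp add: B.int_pow_neg)
    finally show ?thesis
      using BijGroup_inv_apply(2)[of e "carrier X" z] c d by (simp add: g_def BijGroup_mult_apply)
  qed
  ultimately have g: "g \<in> quots"
    using stab by (auto simp: stabilizer_def)
  have "p [^]\<^bsub>B\<^esub> (k - l) = e \<otimes>\<^bsub>B\<^esub> g \<otimes>\<^bsub>B\<^esub> inv\<^bsub>B\<^esub> d"
    using c by (simp add: g_def B.m_assoc) (simp add: B.m_assoc[symmetric])
  then have "p [^]\<^bsub>B\<^esub> (k - l) \<in> quots"
    using d e g subgroup.m_closed[OF subgroup_quots] subgroup.m_inv_closed[OF subgroup_quots] by simp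
  then have "p [^]\<^bsub>B\<^esub> (k - l) = \<one>\<^bsub>B\<^esub>"
    using triv by blast
  then show pow: "p [^]\<^bsub>B\<^esub> k = p [^]\<^bsub>B\<^esub> l"
    using B.int_pow_mult[of p "k - l" l] by simp
  show "d z = e z"
    using eq pow d e BijGroup_inv_apply(2)[of "p [^]\<^bsub>B\<^esub> l" "carrier X"]
    by (metis B.int_pow_closed p_closed quots_apply_closed z)
qed

text \<open>Origin of the indices in \<open>S_sol\<close>: \<sigma> at the first point is
  \<open>s i\<close>, its product with the \<open>j\<close>-th power of \<open>p\<close> is
  \<open>quot i 0\<close> times the next power, and moving that power to the left lowers both
  indices by \<open>j + 1\<close>.\<close>

lemma sigma_pow_p:
  fixes i j :: int
  assumes "d \<in> quots" "e \<in> quots"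
  shows "sigma X ((p [^]\<^bsub>B\<^esub> i) (d z)) ((p [^]\<^bsub>B\<^esub> j) (e z))
    = (p [^]\<^bsub>B\<^esub> (j + 1)) ((e \<otimes>\<^bsub>B\<^esub> quot (i - j - 1) (- j - 1)) z)"
proof -
  have c: "d \<in> carrier B" "e \<in> carrier B"
    using assms quots_closed by auto
  have "shifts (p [^]\<^bsub>B\<^esub> i \<otimes>\<^bsub>B\<^esub> d) i"
    using shifts_mult[OF shifts_pow quots_shifts[OF assms(1)], of i] by simp
  then have "sigma_perm X ((p [^]\<^bsub>B\<^esub> i) (d z)) = s i"
    using s_eq c by (fastforce simp: BijGroup_mult_apply)
  then have "sigma X ((p [^]\<^bsub>B\<^esub> i) (d z)) ((p [^]\<^bsub>B\<^esub> j) (e z)) = s i ((p [^]\<^bsub>B\<^esub> j) (e z))"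
    using sigma_perm_apply[of "(p [^]\<^bsub>B\<^esub> j) (e z)" "(p [^]\<^bsub>B\<^esub> i) (d z)"] assms by simp
  also have "\<dots> = (s i \<otimes>\<^bsub>B\<^esub> p [^]\<^bsub>B\<^esub> j \<otimes>\<^bsub>B\<^esub> e) z"
    using c by (simp add: BijGroup_mult_apply assms)
  also have "s i \<otimes>\<^bsub>B\<^esub> p [^]\<^bsub>B\<^esub> j = quot i 0 \<otimes>\<^bsub>B\<^esub> p [^]\<^bsub>B\<^esub> (j + 1)"
  proof -
    have "inv\<^bsub>B\<^esub> p \<otimes>\<^bsub>B\<^esub> (p \<otimes>\<^bsub>B\<^esub> p [^]\<^bsub>B\<^esub> j) = p [^]\<^bsub>B\<^esub> j"
      by (simp add: B.m_assoc[symmetric])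
    then show ?thesis
      using B.int_pow_mult[of p 1 j]
      by (simp add: quot_def B.m_assoc B.int_pow_1 add.commute)
  qed
  also have "\<dots> = p [^]\<^bsub>B\<^esub> (j + 1) \<otimes>\<^bsub>B\<^esub> quot (i - j - 1) (- j - 1)"
    using pow_mult_quot[of "j + 1" "i - j - 1" "- j - 1"] by simp
  also have "(p [^]\<^bsub>B\<^esub> (j + 1) \<otimes>\<^bsub>B\<^esub> quot (i - j - 1) (- j - 1) \<otimes>\<^bsub>B\<^esub> e) z
      = (p [^]\<^bsub>B\<^esub> (j + 1)) ((quot (i - j - 1) (- j - 1) \<otimes>\<^bsub>B\<^esub> e) z)"
    using c by (simp add: B.m_assoc BijGroup_mult_apply)
  finally show ?thesis
    using quots_commute[OF assms(2) quot_in_quots] by simp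
qed

lemma has_S_form_sufficient:
  assumes triv: "quots \<inter> range (\<lambda>k::int. p [^]\<^bsub>B\<^esub> k) = {\<one>\<^bsub>B\<^esub>}"
    and stab: "stabilizer (perm_group X) (\<lambda>g. g) z \<subseteq> quots"
  shows "has_S_form TYPE('a) X"
proof -
  interpret O: comm_group orbit_group by (rule comm_group_orbit_group)
  define n where "n = (if B.ord p = 0 then \<infinity> else enat (B.ord p))"
  have modulus_n: "modulus n = int (B.ord p)"
    by (simp add: n_def modulus_def)
  have pow_eq_iff: "p [^]\<^bsub>B\<^esub> k = p [^]\<^bsub>B\<^esub> l \<longleftrightarrow> zclass n k = zclass n l" for k l :: int
    using B.int_pow_eq[of p k l] by (simp add: zclass_eq_iff modulus_n dvd_diff_commute)
  have zclass_zclass: "zclass n (zclass n k) = zclass n k" for k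
    by (simp add: zclass_id)
  have pow_zclass: "p [^]\<^bsub>B\<^esub> zclass n k = p [^]\<^bsub>B\<^esub> k" for k
    by (simp add: pow_eq_iff zclass_zclass)
  define c where "c k = quot k 0 z" for k
  \<comment> \<open>\<open>s k\<close> depends on \<open>k\<close> only through the
    \<open>k\<close>-th power of \<open>p\<close>, so \<open>c\<close> is periodic.\<close>
  have c_zclass: "c (zclass n k) = c k" for k
    by (simp add: c_def quot_def s_def pow_zclass)
  have c_closed: "c k \<in> carrier orbit_group" for k
    by (auto simp: c_def orbit_group_def)
  \<comment> \<open>\<open>quot i j\<close> is \<open>quot i 0\<close> times the inverse of
    \<open>quot j 0\<close>; hence the \<open>c i\<close> generate the orbit group.\<close>
  have c_quot: "quot i j z = c i \<otimes>\<^bsub>orbit_group\<^esub> inv\<^bsub>orbit_group\<^esub> c j" for i j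
    by (simp add: c_def orbit_group_inv inv_quot orbit_group_mult quot_mult)
  have c_0: "c 0 = \<one>\<^bsub>orbit_group\<^esub>"
    by (simp add: c_def quot_def BijGroup_one_apply orbit_group_one)
  have c_image: "c ` carrier (Z_group n) = range c"
    using c_zclass by (force simp: carrier_Z_group image_iff)
  have generates: "generate orbit_group (range c) = carrier orbit_group"
  proof
    show "generate orbit_group (range c) \<subseteq> carrier orbit_group"
      using c_closed by (intro O.generate_incl) auto
    have sub: "subgroup (generate orbit_group (range c)) orbit_group"
      using c_closed by (intro O.generate_is_subgroup) auto
    have c_gen: "c i \<in> generate orbit_group (range c)" for i
      by (rule generate.incl) (rule rangeI)
    have "d z \<in> generate orbit_group (range c)" if "d \<in> quots" for d
      using that unfolding quots_def
    proof induction
      case one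
      then show ?case
        using subgroup.one_closed[OF sub] by (simp add: BijGroup_one_apply orbit_group_one)
    next
      case (incl h)
      then show ?case
        by (auto simp: c_quot intro!: subgroup.m_closed[OF sub] subgroup.m_inv_closed[OF sub] c_gen)
    next
      case (inv h)
      then show ?case
        by (auto simp: inv_quot c_quot intro!: subgroup.m_closed[OF sub] subgroup.m_inv_closed[OF sub] c_gen)
    next
      case (eng a b)
      then show ?case
        using orbit_group_mult[of a b] subgroup.m_closed[OF sub eng.IH] unfolding quots_def by simp
    qed
    then show "carrier orbit_group \<subseteq> generate orbit_group (range c)"
      by (auto simp: orbit_group_def)
  qed
  define S where "S = S_sol orbit_group n c"
  \<comment> \<open>This direction has an explicit formula; the isomorphism from \<open>X\<close> is
    its inverse \<Phi> below.\<close>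
  define \<Psi> where "\<Psi> = (\<lambda>(a, k). (p [^]\<^bsub>B\<^esub> (k :: int)) a)"
  have carrier_S: "carrier S = (\<lambda>d. d z) ` quots \<times> carrier (Z_group n)"
    by (simp add: S_def S_sol_def orbit_group_def)
  have bij: "bij_betw \<Psi> (carrier S) (carrier X)"
  proof (rule bij_betw_imageI)
    show "inj_on \<Psi> (carrier S)"
    proof (rule inj_onI)
      fix u v assume u: "u \<in> carrier S" and v: "v \<in> carrier S" and eq: "\<Psi> u = \<Psi> v"
      obtain d k where d: "d \<in> quots" "k \<in> carrier (Z_group n)" "u = (d z, k)"
        using u by (auto simp: carrier_S)
      obtain e l where e: "e \<in> quots" "l \<in> carrier (Z_group n)" "v = (e z, l)"
        using v by (auto simp: carrier_S)
      have "p [^]\<^bsub>B\<^esub> k = p [^]\<^bsub>B\<^esub> l" "d z = e z"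
        using pow_p_quots_inject[OF triv stab d(1) e(1), of k l] eq d e by (simp_all add: \<Psi>_def)
      then show "u = v"
        using d e by (simp add: pow_eq_iff zclass_id)
    qed
    show "\<Psi> ` carrier S = carrier X"
    proof
      show "\<Psi> ` carrier S \<subseteq> carrier X"
        by (auto simp: carrier_S \<Psi>_def)
      show "carrier X \<subseteq> \<Psi> ` carrier S"
      proof
        fix x assume "x \<in> carrier X"
        then obtain d and k :: int where d: "d \<in> quots" "x = (p [^]\<^bsub>B\<^esub> k) (d z)"
          by (rule pow_p_quots_decomp)
        then have "x = \<Psi> (d z, zclass n k)"
          by (simp add: \<Psi>_def pow_zclass)
        then show "x \<in> \<Psi> ` carrier S"
          using d by (auto simp: carrier_S)
      qed
    qed
  qed
  \<comment> \<open>Membership in \<open>carrier S\<close> is included because inverting \<Psi>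
    requires it.\<close>
  have hom: "\<Psi> (sigma S u v) = sigma X (\<Psi> u) (\<Psi> v) \<and> sigma S u v \<in> carrier S"
    if uv: "u \<in> carrier S" "v \<in> carrier S" for u v
  proof -
    obtain d i where u: "d \<in> quots" "u = (d z, i)"
      using uv by (auto simp: carrier_S)
    obtain e j where v: "e \<in> quots" "v = (e z, j)"
      using uv by (auto simp: carrier_S)
    let ?q = "quot (i - j - 1) (- j - 1)"
    have eq: "e \<otimes>\<^bsub>B\<^esub> ?q \<in> quots"
      using v(1) by (simp add: subgroup.m_closed[OF subgroup_quots])
    have "e z \<in> carrier orbit_group"
      using v(1) by (simp add: orbit_group_def)
    then have "e z \<otimes>\<^bsub>orbit_group\<^esub> c (i - j - 1) \<otimes>\<^bsub>orbit_group\<^esub> inv\<^bsub>orbit_group\<^esub> c (- j - 1)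
        = (e \<otimes>\<^bsub>B\<^esub> ?q) z"
      using c_quot[of "i - j - 1" "- j - 1"] orbit_group_mult[OF v(1) quot_in_quots[of "i - j - 1" "- j - 1"]]
      by (simp add: O.m_assoc c_closed)
    then have "sigma S u v = ((e \<otimes>\<^bsub>B\<^esub> ?q) z, zclass n (j + 1))"
      by (simp add: S_def S_sol_def u v c_zclass)
    then show ?thesis
      using eq sigma_pow_p[OF u(1) v(1)] by (simp add: \<Psi>_def pow_zclass carrier_S u v)
  qed
  define \<Phi> where "\<Phi> = inv_into (carrier S) \<Psi>"
  have \<Phi>: "bij_betw \<Phi> (carrier X) (carrier S)"
    unfolding \<Phi>_def by (rule bij_betw_inv_into[OF bij])
  have "\<Phi> (sigma X x y) = sigma S (\<Phi> x) (\<Phi> y)" if "x \<in> carrier X" "y \<in> carrier X" for x y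
  proof -
    have "\<Phi> x \<in> carrier S" "\<Phi> y \<in> carrier S" "\<Psi> (\<Phi> x) = x" "\<Psi> (\<Phi> y) = y"
      using that bij \<Phi> unfolding \<Phi>_def by (auto simp: bij_betw_inv_into_right dest: bij_betwE)
    then show ?thesis
      using hom[of "\<Phi> x" "\<Phi> y"] bij_betw_inv_into_left[OF bij] unfolding \<Phi>_def by metis
  qed
  then have "ybe_isomorphic X S"
    unfolding ybe_isomorphic_def ybe_hom_def using \<Phi> bij_betw_imp_funcset[OF \<Phi>] by blast
  moreover have "n \<ge> 1"
    by (auto simp: n_def one_enat_def)
  moreover have "c \<in> carrier (Z_group n) \<rightarrow> carrier orbit_group"
    using c_closed by simp
  ultimately show ?thesis
    unfolding has_S_form_def S_def using comm_group_orbit_group c_0 generates c_image by metis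
qed

section \<open>Necessity of the two group conditions\<close>

lemma pow_p_eq_one_of_S_form:
  fixes k :: int
  assumes G: "comm_group G" and c: "c \<in> carrier (Z_group n) \<rightarrow> carrier G"
    and hom: "\<Phi> \<in> ybe_hom X (S_sol G n c)" and inj: "inj_on \<Phi> (carrier X)"
    and k: "modulus n dvd k"
  shows "p [^]\<^bsub>B\<^esub> k = \<one>\<^bsub>B\<^esub>"
proof (cases "modulus n = 0")
  case True
  then show ?thesis using k by simp
next
  case False
  then obtain m where m: "n = enat m" "m > 0" "modulus n = int m"
    by (cases n) (auto simp: modulus_def)
  interpret G: comm_group G by (rule G)
  \<comment> \<open>The indices fall because each application of \<open>p\<close> raises the second
    coordinate. After \<open>t\<close> steps the first coordinate has gained one such product and
    the inverse of another; for \<open>t = m\<close> both run over all residues and cancel.\<close>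
  define P where "P a t = finprod G (\<lambda>u. c (zclass n (a - int u))) {..<t}" for a :: int and t :: nat
  have c_closed: "c (zclass n i) \<in> carrier G" for i
    using c by auto
  have P_closed: "P a t \<in> carrier G" for a t
    unfolding P_def using c_closed by (intro G.finprod_closed) auto
  have P_Suc: "P a (Suc t) = P a t \<otimes>\<^bsub>G\<^esub> c (zclass n (a - int t))" for a t
    unfolding P_def lessThan_Suc using c_closed P_closed[of a t]
    by (simp add: G.m_comm P_def Pi_def)
  have P_m: "P a m = P b m" for a b
  proof -
    have "c \<in> {0..<int m} \<rightarrow> carrier G"
      using c m by (simp add: Z_group_def carrier_integer_mod_group)
    then show ?thesis
      using G.finprod_full_cycle[OF m(2), of c] by (simp add: P_def zclass_eq_mod m(3))
  qed
  have formula: "\<Phi> ((p [^]\<^bsub>B\<^esub> t) x) = (b \<otimes>\<^bsub>G\<^esub> P (i - j - 1) t \<otimes>\<^bsub>G\<^esub> inv\<^bsub>G\<^esub> P (- j - 1) t, zclass n (j + int t))"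
    if x: "x \<in> carrier X" and \<Phi>x: "\<Phi> x = (b, j)" and \<Phi>z: "\<Phi> z = (a, i)" for t :: nat and x a b i j
  proof (induction t)
    have bj: "b \<in> carrier G" "j \<in> carrier (Z_group n)"
      using hom x \<Phi>x by (auto simp: ybe_hom_def S_sol_def Pi_iff)
    {
      case 0
      then show ?case
        using bj by (simp add: BijGroup_one_apply x \<Phi>x P_def zclass_id)
    next
      case (Suc t)
      have w: "(p [^]\<^bsub>B\<^esub> t) x \<in> carrier X"
        using BijGroup_closed[of "p [^]\<^bsub>B\<^esub> t" "carrier X" x] x by simp
      \<comment> \<open>Replacing the second coordinate by its representative does not change
        residues, so the inner \<open>zclass\<close> drop out of the indices.\<close>
      have "modulus n dvd (j + int t) - zclass n (j + int t)"
        unfolding zclass_eq_iff[symmetric] by (simp add: zclass_id)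
      moreover from this have "modulus n dvd zclass n (j + int t) - (j + int t)"
        by (simp only: dvd_diff_commute)
      ultimately have z1: "zclass n (i - zclass n (j + int t) - 1) = zclass n (i - j - 1 - int t)"
        and z2: "zclass n (- zclass n (j + int t) - 1) = zclass n (- j - 1 - int t)"
        and z3: "zclass n (zclass n (j + int t) + 1) = zclass n (j + int (Suc t))"
        unfolding zclass_eq_iff by (simp_all add: algebra_simps)
      have "(p [^]\<^bsub>B\<^esub> Suc t) x = sigma X z ((p [^]\<^bsub>B\<^esub> t) x)"
        using B.nat_pow_Suc2[OF p_closed, of t] w x by (simp add: BijGroup_mult_apply p_def)
      then have "\<Phi> ((p [^]\<^bsub>B\<^esub> Suc t) x) = sigma (S_sol G n c) (\<Phi> z) (\<Phi> ((p [^]\<^bsub>B\<^esub> t) x))"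
        using hom w by (simp add: ybe_hom_def)
      also have "\<dots> = (b \<otimes>\<^bsub>G\<^esub> P (i - j - 1) t \<otimes>\<^bsub>G\<^esub> inv\<^bsub>G\<^esub> P (- j - 1) t
          \<otimes>\<^bsub>G\<^esub> c (zclass n (i - j - 1 - int t)) \<otimes>\<^bsub>G\<^esub> inv\<^bsub>G\<^esub> c (zclass n (- j - 1 - int t)), zclass n (j + int (Suc t)))"
        unfolding Suc.IH \<Phi>z by (simp add: S_sol_def z1 z2 z3)
      finally show ?case
        using bj P_closed c_closed by (simp add: P_Suc G.inv_mult G.m_ac)
    }
  qed
  have "p [^]\<^bsub>B\<^esub> m = \<one>\<^bsub>B\<^esub>"
  proof (rule BijGroup_eqI)
    fix x assume x: "x \<in> carrier X"
    obtain a i where \<Phi>z: "\<Phi> z = (a, i)" by fastforce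
    obtain b j where \<Phi>x: "\<Phi> x = (b, j)" by fastforce
    have bj: "b \<in> carrier G" "j \<in> carrier (Z_group n)"
      using hom x \<Phi>x by (auto simp: ybe_hom_def S_sol_def Pi_iff)
    have "zclass n (j + int m) = j"
      using zclass_id[OF bj(2)] by (simp add: zclass_eq_mod m(3))
    then have "\<Phi> ((p [^]\<^bsub>B\<^esub> m) x) = \<Phi> x"
      using formula[OF x \<Phi>x \<Phi>z, of m] P_m[of "i - j - 1" "- j - 1"] P_closed bj(1)
      by (simp add: \<Phi>x G.m_assoc)
    then have "(p [^]\<^bsub>B\<^esub> m) x = x"
      using inj x BijGroup_closed[of "p [^]\<^bsub>B\<^esub> m" "carrier X" x] by (simp add: inj_on_def)
    then show "(p [^]\<^bsub>B\<^esub> m) x = \<one>\<^bsub>B\<^esub> x"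
      using x by (simp add: BijGroup_one_apply)
  qed auto
  \<comment> \<open>Passing to the order of \<open>p\<close> covers all integer multiples of the
    modulus, negative ones included.\<close>
  then have "int (B.ord p) dvd modulus n"
    using B.pow_eq_id[OF p_closed] by (simp add: m(3))
  then have "int (B.ord p) dvd k"
    using k by (rule dvd_trans)
  then show ?thesis
    by (simp add: B.int_pow_eq_id)
qed

lemma has_S_form_necessary:
  assumes "has_S_form TYPE('g) X"
  shows "quots \<inter> range (\<lambda>k::int. p [^]\<^bsub>B\<^esub> k) = {\<one>\<^bsub>B\<^esub>}"
    and "stabilizer (perm_group X) (\<lambda>g. g) z \<subseteq> quots"
proof -
  obtain n and G :: "'g monoid" and c \<Phi> where G: "comm_group G"
    and c: "c \<in> carrier (Z_group n) \<rightarrow> carrier G"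
    and hom: "\<Phi> \<in> ybe_hom X (S_sol G n c)" and bij: "bij_betw \<Phi> (carrier X) (carrier (S_sol G n c))"
    using assms unfolding has_S_form_def ybe_isomorphic_def by auto
  have pow_one: "p [^]\<^bsub>B\<^esub> k = \<one>\<^bsub>B\<^esub>" if "modulus n dvd k" for k :: int
    using pow_p_eq_one_of_S_form[OF G c hom bij_betw_imp_inj_on[OF bij] that] .
  define \<psi> where "\<psi> x = snd (\<Phi> x)" for x
  \<comment> \<open>Here \<open>g\<close> adds \<open>k\<close> to the second coordinate modulo
    \<open>n\<close>. The amounts add up under products: they are 1 for each \<sigma> and 0 on
    \<open>quots\<close>.\<close>
  define moves where
    "moves g k \<longleftrightarrow> g \<in> carrier B \<and> (\<forall>x \<in> carrier X. modulus n dvd \<psi> (g x) - \<psi> x - k)" for g k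
  have moves_sigma: "moves (sigma_perm X x) 1" if "x \<in> carrier X" for x
  proof -
    have "modulus n dvd \<psi> (sigma X x y) - \<psi> y - 1" if y: "y \<in> carrier X" for y
    proof -
      have "\<psi> (sigma X x y) = zclass n (\<psi> y + 1)"
        using hom y \<open>x \<in> carrier X\<close> by (simp add: ybe_hom_def \<psi>_def S_sol_def split: prod.splits)
      then have "zclass n (\<psi> (sigma X x y)) = zclass n (\<psi> y + 1)"
        by (simp add: zclass_id)
      then show ?thesis
        by (simp add: zclass_eq_iff algebra_simps)
    qed
    then show ?thesis
      using that by (simp add: moves_def)
  qed
  have moves_mult: "moves (g \<otimes>\<^bsub>B\<^esub> h) (k + l)" if "moves g k" "moves h l" for g h k l
  proof -
    have "modulus n dvd \<psi> (g (h x)) - \<psi> x - (k + l)" if x: "x \<in> carrier X" for x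
    proof -
      have "modulus n dvd (\<psi> (g (h x)) - \<psi> (h x) - k) + (\<psi> (h x) - \<psi> x - l)"
        using \<open>moves g k\<close> \<open>moves h l\<close> x BijGroup_closed[of h "carrier X" x]
        by (intro dvd_add) (simp_all add: moves_def)
      then show ?thesis by (simp add: algebra_simps)
    qed
    then show ?thesis
      using that by (simp add: moves_def BijGroup_mult_apply)
  qed
  have moves_inv: "moves (inv\<^bsub>B\<^esub> g) (- k)" if "moves g k" for g k
  proof -
    have g: "g \<in> carrier B"
      using that by (simp add: moves_def)
    have "modulus n dvd \<psi> ((inv\<^bsub>B\<^esub> g) x) - \<psi> x + k" if x: "x \<in> carrier X" for x
    proof -
      have "(inv\<^bsub>B\<^esub> g) x \<in> carrier X"
        using g x BijGroup_closed[of "inv\<^bsub>B\<^esub> g" "carrier X" x] by simp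
      then have "modulus n dvd - (\<psi> x - \<psi> ((inv\<^bsub>B\<^esub> g) x) - k)"
        using \<open>moves g k\<close> BijGroup_inv_apply(1)[OF g x] unfolding moves_def dvd_minus_iff by metis
      then show ?thesis by (simp add: algebra_simps)
    qed
    then show ?thesis
      using g by (simp add: moves_def)
  qed
  have moves_one: "moves \<one>\<^bsub>B\<^esub> 0"
    by (simp add: moves_def BijGroup_one_apply)
  have moves_s: "moves (s i) 1" for i
    unfolding s_def by (rule moves_sigma) simp
  have moves_pow: "moves (p [^]\<^bsub>B\<^esub> k) k" for k :: int
  proof (induction k rule: int_induct[where k = 0])
    case base
    then show ?case using moves_one by simp
  next
    case (step1 k)
    then show ?case
      using moves_mult[OF step1(2) moves_s[of 0]] B.int_pow_mult[of p k 1] by (simp add: B.int_pow_1)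
  next
    case (step2 k)
    then show ?case
      using moves_mult[OF step2(2) moves_inv[OF moves_s[of 0]]] B.int_pow_mult[of p k "-1"]
      by (simp add: B.int_pow_neg B.int_pow_1)
  qed
  have moves_quots: "moves d 0" if "d \<in> quots" for d
  proof -
    have q: "moves (quot i j) 0" for i j
      using moves_mult[OF moves_s[of i] moves_inv[OF moves_s[of j]]] by (simp add: quot_def)
    show ?thesis
      using that unfolding quots_def
    proof induction
      case (eng a b)
      then show ?case using moves_mult[of a 0 b 0] by simp
    qed (auto simp: moves_one inv_quot q)
  qed
  show "quots \<inter> range (\<lambda>k::int. p [^]\<^bsub>B\<^esub> k) = {\<one>\<^bsub>B\<^esub>}"
  proof
    have "p [^]\<^bsub>B\<^esub> k = \<one>\<^bsub>B\<^esub>" if "p [^]\<^bsub>B\<^esub> k \<in> quots" for k :: int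
    proof (rule pow_one)
      \<comment> \<open>A power of \<open>p\<close> in \<open>quots\<close> moves \<open>z\<close>
        both by 0 and by \<open>k\<close>.\<close>
      have "modulus n dvd (\<psi> ((p [^]\<^bsub>B\<^esub> k) z) - \<psi> z - 0) - (\<psi> ((p [^]\<^bsub>B\<^esub> k) z) - \<psi> z - k)"
        using moves_pow[of k] moves_quots[OF that] z unfolding moves_def by (blast intro: dvd_diff)
      then show "modulus n dvd k" by simp
    qed
    then show "quots \<inter> range (\<lambda>k::int. p [^]\<^bsub>B\<^esub> k) \<subseteq> {\<one>\<^bsub>B\<^esub>}"
      by auto
    show "{\<one>\<^bsub>B\<^esub>} \<subseteq> quots \<inter> range (\<lambda>k::int. p [^]\<^bsub>B\<^esub> k)"
      using subgroup.one_closed[OF subgroup_quots] by (auto intro: range_eqI[of _ _ 0])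
  qed
  show "stabilizer (perm_group X) (\<lambda>g. g) z \<subseteq> quots"
  proof
    fix g assume "g \<in> stabilizer (perm_group X) (\<lambda>g. g) z"
    then have g: "g \<in> generate B (range s)" "g z = z"
      by (auto simp: stabilizer_def carrier_perm_group')
    obtain d and k :: int where d: "d \<in> quots" "g = d \<otimes>\<^bsub>B\<^esub> p [^]\<^bsub>B\<^esub> k"
      using generate_range_eq_quots_mult_pow[OF g(1)] by auto
    \<comment> \<open>As \<open>g\<close> fixes \<open>z\<close>, \<open>n\<close> divides
      \<open>k\<close>; the power of \<open>p\<close> is then trivial and
      \<open>g = d\<close>.\<close>
    have "moves g k"
      using moves_mult[OF moves_quots[OF d(1)] moves_pow[of k]] d(2) by simp
    then have "modulus n dvd k"
      using g(2) z unfolding moves_def by fastforce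
    then show "g \<in> quots"
      using d pow_one quots_closed by simp
  qed
qed

end

text \<open>The type of G is harmless: a form over any \<open>'g\<close> implies \<open>C\<close>,
  and \<open>C\<close> yields a form over the type of the points, carried by the orbit of
  \<open>z\<close>.\<close>

theorem corollary5p3:
  fixes X :: "'a ybe" and z :: 'a and \<pi> :: "'a \<Rightarrow> 'a"
  assumes "ybe_solution X"
    and "indecomposable X"
    and "mp_level_1 X \<or> mp_level_2 X"
    and "z \<in> carrier X"
    and "\<pi> = sigma_perm X z"
  defines "C \<equiv> carrier (dis_group X) \<inter> carrier (subgroup_generated (BijGroup (carrier X)) {\<pi>})
                 = {\<one>\<^bsub>BijGroup (carrier X)\<^esub>}
               \<and> stabilizer (perm_group X) (\<lambda>g. g) z \<subseteq> carrier (dis_group X)"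
  shows "(has_S_form TYPE('a) X \<longleftrightarrow> C) \<and> (has_S_form TYPE('g) X \<longrightarrow> C)"
proof -
  interpret ybe_solution X by (rule assms(1))
  interpret level2_solution X z
  proof unfold_locales
    show "(tau X x w, tau X y w) \<in> ret_rel X"
      if "x \<in> carrier X" "y \<in> carrier X" "w \<in> carrier X" for x y w
      using level_at_most_2_tau[OF assms(3) that] .
    show "\<exists>g \<in> carrier (perm_group X). g z = x" if "x \<in> carrier X" for x
      using assms(2,4) that unfolding indecomposable_def by (rule transitive_action.unique_orbit)
  qed (rule assms(4))
  have "carrier (subgroup_generated (BijGroup (carrier X)) {\<pi>}) = range (\<lambda>k::int. p [^]\<^bsub>B\<^esub> k)"
    using group.carrier_subgroup_generated_by_singleton[OF group_BijGroup p_closed] assms(5)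
    by (simp add: p_def)
  then have C: "C \<longleftrightarrow> quots \<inter> range (\<lambda>k::int. p [^]\<^bsub>B\<^esub> k) = {\<one>\<^bsub>B\<^esub>}
      \<and> stabilizer (perm_group X) (\<lambda>g. g) z \<subseteq> quots"
    by (simp add: C_def carrier_dis_group)
  show ?thesis
    unfolding C using has_S_form_sufficient has_S_form_necessary[where 'g = 'a]
      has_S_form_necessary[where 'g = 'g] by blast
qed

end
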